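(* Let $A$ be an additively idempotent semiring and $M$ an $A$-semimodule. Then $M$ is injective if and only if $M$ is a retract of the $A$-semimodule $\mathrm{Id}(A)^X$ for some set $X$.
   Context: A semiring $(A,+,0,\cdot,1)$ consists of a commutative monoid $(A,+,0)$ and a monoid $(A,\cdot,1)$ with $\cdot$ distributing over $+$ on both sides and $a0=0=0a$. It is additively idempotent if $a+a=a$; then $+$ is written $\vee$, with order $x\le y\iff x\vee y=y$. A (left) $A$-semimodule is a commutative monoid $(M,+,0)$ with a scalar multiplication $A\times M\to M$ satisfying $(ab)\cdot x=a\cdot(b\cdot x)$, $a\cdot(x+y)=a\cdot x+a\cdot y$, $(a+b)\cdot x=a\cdot x+b\cdot x$, $0_A\cdot x=0_M=a\cdot 0_M$, $1\cdot x=x$. Homomorphisms of $A$-semimodules preserve $+$ and scalar multiplication. An $A$-semimodule $E$ is injective if for every $A$-semimodule $M$, every subsemimodule $N$ of $M$, and every homomorphism $\alpha:N\to E$, there is a homomorphism $\beta:M\to E$ extending $\alpha$. A semimodule $M$ is a retract of $M'$ if there are homomorphisms $r:M'\to M$, $s:M\to M'$ with $rs$ the identity on $M$. $\mathrm{Id}(A)$ is the set of ideals of the join-semilattice $(A,\vee,0)$, i.e. nonempty subsets $I\subseteq A$ such that $a,b\in I$ implies $a\vee b\in I$, and $a\in I$, $b\le a$ implies $b\in I$. It is an $A$-semimodule with addition $I\cap J$ (so it is ordered by reverse inclusion), zero element $A$, and scalar multiplication $a\cdot I=\{x\in A\mid xa\in I\}$. $\mathrm{Id}(A)^X$ is the direct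 power with componentwise operations. *)

theory Defs
  imports "HOL-Algebra.Module"
begin

locale idempotent_semiring = semiring A for A (structure) +
  assumes add_idem: "x \<in> carrier A \<Longrightarrow> x \<oplus> x = x"

text \<open>
  Semimodules are carried by the library record \<open>module\<close>; as for library modules,
  its inherited fields \<open>mult\<close> and \<open>one\<close> play no role.
\<close>

locale semimodule = A?: semiring A + M?: abelian_monoid M for A (structure) and M (structure) +
  assumes smult_closed:
      "\<lbrakk>a \<in> carrier A; x \<in> carrier M\<rbrakk> \<Longrightarrow> a \<odot>\<^bsub>M\<^esub> x \<in> carrier M"
    and smult_assoc:
      "\<lbrakk>a \<in> carrier A; b \<in> carrier A; x \<in> carrier M\<rbrakk> \<Longrightarrow>
        (a \<otimes>\<^bsub>A\<^esub> b) \<odot>\<^bsub>M\<^esub> x = a \<odot>\<^bsub>M\<^esub> (b \<odot>\<^bsub>M\<^esub> x)"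
    and smult_r_distr:
      "\<lbrakk>a \<in> carrier A; x \<in> carrier M; y \<in> carrier M\<rbrakk> \<Longrightarrow>
        a \<odot>\<^bsub>M\<^esub> (x \<oplus>\<^bsub>M\<^esub> y) = a \<odot>\<^bsub>M\<^esub> x \<oplus>\<^bsub>M\<^esub> a \<odot>\<^bsub>M\<^esub> y"
    and smult_l_distr:
      "\<lbrakk>a \<in> carrier A; b \<in> carrier A; x \<in> carrier M\<rbrakk> \<Longrightarrow>
        (a \<oplus>\<^bsub>A\<^esub> b) \<odot>\<^bsub>M\<^esub> x = a \<odot>\<^bsub>M\<^esub> x \<oplus>\<^bsub>M\<^esub> b \<odot>\<^bsub>M\<^esub> x"
    and smult_l_zero: "x \<in> carrier M \<Longrightarrow> \<zero>\<^bsub>A\<^esub> \<odot>\<^bsub>M\<^esub> x = \<zero>\<^bsub>M\<^esub>"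
    and smult_r_zero: "a \<in> carrier A \<Longrightarrow> a \<odot>\<^bsub>M\<^esub> \<zero>\<^bsub>M\<^esub> = \<zero>\<^bsub>M\<^esub>"
    and smult_one: "x \<in> carrier M \<Longrightarrow> \<one>\<^bsub>A\<^esub> \<odot>\<^bsub>M\<^esub> x = x"

locale subsemimodule = submonoid N "add_monoid M"
  for N and A :: "('a, 'c) ring_scheme" and M :: "('a, 'm, 'd) module_scheme" (structure) +
  assumes smult_closed: "\<lbrakk>a \<in> carrier A; x \<in> N\<rbrakk> \<Longrightarrow> a \<odot>\<^bsub>M\<^esub> x \<in> N"

text \<open>
  Preservation of zero is automatic between semimodules, since zero is the
  scalar multiple of any element by the zero of the semiring.
\<close>

definition semimodule_hom ::
  "('a, 'c) ring_scheme \<Rightarrow> ('a, 'm, 'd) module_scheme \<Rightarrow> ('a, 'n, 'e) module_scheme \<Rightarrow> ('m \<Rightarrow> 'n) set"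
  where "semimodule_hom A M N =
    {h. h \<in> carrier M \<rightarrow> carrier N \<and>
      (\<forall>x \<in> carrier M. \<forall>y \<in> carrier M. h (x \<oplus>\<^bsub>M\<^esub> y) = h x \<oplus>\<^bsub>N\<^esub> h y) \<and>
      (\<forall>a \<in> carrier A. \<forall>x \<in> carrier M. h (a \<odot>\<^bsub>M\<^esub> x) = a \<odot>\<^bsub>N\<^esub> h x)}"

text \<open>
  The extension property for all semimodules whose carrier is a subset of the
  type \<open>'u\<close>; HOL cannot quantify over types inside a formula, so \<open>'u\<close> is a parameter.
\<close>

definition injective_semimodule ::
  "'u itself \<Rightarrow> ('a, 'c) ring_scheme \<Rightarrow> ('a, 'm, 'd) module_scheme \<Rightarrow> bool"
  where "injective_semimodule U A E \<longleftrightarrow>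
    (\<forall>(M :: ('a, 'u) module) N. semimodule A M \<and> subsemimodule N A M \<longrightarrow>
      (\<forall>\<alpha> \<in> semimodule_hom A (M\<lparr>carrier := N\<rparr>) E.
        \<exists>\<beta> \<in> semimodule_hom A M E. \<forall>x \<in> N. \<beta> x = \<alpha> x))"

definition semimodule_retract ::
  "('a, 'c) ring_scheme \<Rightarrow> ('a, 'm, 'd) module_scheme \<Rightarrow> ('a, 'n, 'e) module_scheme \<Rightarrow> bool"
  where "semimodule_retract A M M' \<longleftrightarrow>
    (\<exists>r \<in> semimodule_hom A M' M. \<exists>s \<in> semimodule_hom A M M'. \<forall>x \<in> carrier M. r (s x) = x)"

definition semiring_le :: "('a, 'c) ring_scheme \<Rightarrow> 'a \<Rightarrow> 'a \<Rightarrow> bool"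
  where "semiring_le A x y \<longleftrightarrow> x \<oplus>\<^bsub>A\<^esub> y = y"

definition semilattice_ideals :: "('a, 'c) ring_scheme \<Rightarrow> 'a set set"
  where "semilattice_ideals A =
    {I. I \<subseteq> carrier A \<and> I \<noteq> {} \<and>
      (\<forall>a \<in> I. \<forall>b \<in> I. a \<oplus>\<^bsub>A\<^esub> b \<in> I) \<and>
      (\<forall>a \<in> I. \<forall>b \<in> carrier A. semiring_le A b a \<longrightarrow> b \<in> I)}"

definition Id_semimodule :: "('a, 'c) ring_scheme \<Rightarrow> ('a, 'a set) module"
  where "Id_semimodule A =
    \<lparr>carrier = semilattice_ideals A, mult = undefined, one = undefined,
     zero = carrier A, add = (\<inter>),
     smult = (\<lambda>a I. {x \<in> carrier A. x \<otimes>\<^bsub>A\<^esub> a \<in> I})\<rparr>"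

definition power_semimodule ::
  "('a, 'm, 'd) module_scheme \<Rightarrow> 'x set \<Rightarrow> ('a, 'x \<Rightarrow> 'm) module"
  where "power_semimodule M X =
    \<lparr>carrier = X \<rightarrow>\<^sub>E carrier M, mult = undefined, one = undefined,
     zero = (\<lambda>i\<in>X. \<zero>\<^bsub>M\<^esub>), add = (\<lambda>f g. \<lambda>i\<in>X. f i \<oplus>\<^bsub>M\<^esub> g i),
     smult = (\<lambda>a f. \<lambda>i\<in>X. a \<odot>\<^bsub>M\<^esub> f i)\<rparr>"

lemma (in idempotent_semiring) semimodule_Id: "semimodule A (Id_semimodule A)"
proof -
  have le_add: "semiring_le A x (x \<oplus> y)" "semiring_le A y (x \<oplus> y)"
    if "x \<in> carrier A" "y \<in> carrier A" for x y
    using that add_idem unfolding semiring_le_def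
    by (metis a_assoc) (metis a_assoc a_comm add_idem that)
  have add_mem: "x \<oplus> y \<in> I \<longleftrightarrow> x \<in> I \<and> y \<in> I"
    if "I \<in> semilattice_ideals A" "x \<in> carrier A" "y \<in> carrier A" for I x y
    using that le_add[of x y] by (auto simp: semilattice_ideals_def)
  have zero_mem: "\<zero> \<in> I" if "I \<in> semilattice_ideals A" for I
    using that by (force simp: semilattice_ideals_def semiring_le_def)
  have ideal_smult: "{x \<in> carrier A. x \<otimes> a \<in> I} \<in> semilattice_ideals A"
    if a: "a \<in> carrier A" and I: "I \<in> semilattice_ideals A" for a I
  proof -
    have "b \<otimes> a \<in> I" if "c \<in> carrier A" "c \<otimes> a \<in> I" "b \<in> carrier A" "b \<oplus> c = c" for b c
      using add_mem[OF I, of "b \<otimes> a" "c \<otimes> a"] that a by (simp add: l_distr[symmetric])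
    moreover have "\<zero> \<otimes> a \<in> I" using zero_mem[OF I] a by simp
    moreover have "(b \<oplus> c) \<otimes> a \<in> I"
      if "b \<in> carrier A" "c \<in> carrier A" "b \<otimes> a \<in> I" "c \<otimes> a \<in> I" for b c
      using add_mem[OF I] that a by (simp add: l_distr)
    ultimately show ?thesis
      unfolding semilattice_ideals_def semiring_le_def by blast
  qed
  have sub: "I \<subseteq> carrier A" if "I \<in> semilattice_ideals A" for I
    using that by (simp add: semilattice_ideals_def)
  have mem_carrier: "x \<in> carrier A" if "I \<in> semilattice_ideals A" "x \<in> I" for I x
    using that sub by blast
  have car: "carrier A \<in> semilattice_ideals A"
    unfolding semilattice_ideals_def by auto
  have Int: "I \<inter> J \<in> semilattice_ideals A"
    if "I \<in> semilattice_ideals A" "J \<in> semilattice_ideals A" for I J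
    using zero_mem[OF that(1)] zero_mem[OF that(2)] that
    unfolding semilattice_ideals_def by blast
  have "comm_monoid (add_monoid (Id_semimodule A))"
    by (rule comm_monoidI) (use Int car sub in \<open>auto simp: Id_semimodule_def\<close>)
  then show ?thesis
    unfolding semimodule_def semimodule_axioms_def abelian_monoid_def
    using semiring_axioms ideal_smult zero_mem
    by (auto simp: Id_semimodule_def m_assoc r_distr add_mem mem_carrier)
qed

lemma semimodule_power:
  assumes "semimodule A M"
  shows "semimodule A (power_semimodule M X)"
proof -
  interpret semimodule A M by fact
  have "comm_monoid (add_monoid (power_semimodule M X))"
    by (rule comm_monoidI)
      (auto simp: power_semimodule_def PiE_iff extensional_def fun_eq_iff M.a_ac)
  then show ?thesis
    unfolding semimodule_def semimodule_axioms_def abelian_monoid_def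
    using A.semiring_axioms
    by (auto simp: power_semimodule_def PiE_iff extensional_def fun_eq_iff smult_closed
      smult_assoc smult_l_distr smult_r_distr smult_l_zero smult_r_zero smult_one)
qed

end

theory Submission
  imports Defs
begin

text \<open>
  Homomorphisms \<open>h\<close> from a semimodule \<open>M\<close> to \<open>Id(A)\<close> correspond to join-semilattice ideals \<open>J\<close> of \<open>M\<close>:
  from \<open>h\<close> one gets \<open>J = {x. 1 \<in> h x}\<close>, and \<open>J\<close> gives back \<open>h x = {a. a x \<in> J}\<close>. An ideal of a
  subsemimodule is the trace of the ideal it generates, so \<open>Id(A)\<close> is injective, and so are its
  powers and their retracts. Conversely the principal ideals of \<open>M\<close> yield an embedding of \<open>M\<close> into
  \<open>Id(A)\<close> to the power \<open>M\<close>, and an injective \<open>M\<close> is a retract of any semimodule that contains it.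
\<close>

section \<open>Join-semilattice ideals of a semimodule\<close>

text \<open>One equivalence covers both closure under joins and downward closure, as
  \<open>x\<close> lies below \<open>y\<close> when their join is \<open>y\<close>. Only the part of
  \<open>J\<close> inside the carrier is constrained.\<close>

definition semimodule_ideal :: "('a, 'm, 'd) module_scheme \<Rightarrow> 'm set \<Rightarrow> bool"
  where "semimodule_ideal M J \<longleftrightarrow> \<zero>\<^bsub>M\<^esub> \<in> J \<and>
    (\<forall>x \<in> carrier M. \<forall>y \<in> carrier M. x \<oplus>\<^bsub>M\<^esub> y \<in> J \<longleftrightarrow> x \<in> J \<and> y \<in> J)"

text \<open>Idempotence passes from the scalars to \<open>M\<close> because 1 = 1 + 1, so
  \<open>semiring_le M\<close> is a join-semilattice order on \<open>M\<close>.\<close>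

lemma semimodule_add_idem:
  assumes "idempotent_semiring A" "semimodule A M" "x \<in> carrier M"
  shows "x \<oplus>\<^bsub>M\<^esub> x = x"
proof -
  interpret idempotent_semiring A by fact
  interpret semimodule A M by fact
  show ?thesis
    using smult_l_distr[of "\<one>\<^bsub>A\<^esub>" "\<one>\<^bsub>A\<^esub>" x] assms(3) by (simp add: add_idem smult_one)
qed

lemma semimodule_le_add_iff:
  assumes "idempotent_semiring A" "semimodule A M"
    and "x \<in> carrier M" "y \<in> carrier M" "z \<in> carrier M"
  shows "semiring_le M (x \<oplus>\<^bsub>M\<^esub> y) z \<longleftrightarrow> semiring_le M x z \<and> semiring_le M y z"
proof -
  interpret semimodule A M by fact
  note idem = semimodule_add_idem[OF assms(1,2)]
  show ?thesis
    unfolding semiring_le_def using assms(3-5) idem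
    by (metis M.a_assoc M.a_comm M.add.m_closed)
qed

lemma semimodule_ideal_principal:
  assumes "idempotent_semiring A" "semimodule A M" "z \<in> carrier M"
  shows "semimodule_ideal M {x. semiring_le M x z}"
proof -
  interpret semimodule A M by fact
  show ?thesis
    using semimodule_le_add_iff[OF assms(1,2) _ _ assms(3)] assms(3)
    by (auto simp: semimodule_ideal_def) (simp add: semiring_le_def)
qed

text \<open>Closing \<open>J\<close> downwards in \<open>M\<close> is enough, since \<open>J\<close>
  already has joins: if \<open>i\<close> and \<open>j\<close> in \<open>J\<close> bound
  \<open>x\<close> and \<open>y\<close>, their join bounds the join of \<open>x\<close> and
  \<open>y\<close>.\<close>

lemma semimodule_ideal_generated:
  assumes A: "idempotent_semiring A" and M: "semimodule A M"
    and N: "N \<subseteq> carrier M" and J: "semimodule_ideal (M\<lparr>carrier := N\<rparr>) J" "J \<subseteq> N"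
    and closed: "\<And>x y. x \<in> N \<Longrightarrow> y \<in> N \<Longrightarrow> x \<oplus>\<^bsub>M\<^esub> y \<in> N"
  shows "semimodule_ideal M {x. \<exists>j \<in> J. semiring_le M x j}"
proof -
  interpret semimodule A M by fact
  have J_add: "i \<oplus>\<^bsub>M\<^esub> j \<in> J" if "i \<in> J" "j \<in> J" for i j
    using J that by (auto simp: semimodule_ideal_def)
  have J_carrier: "j \<in> carrier M" if "j \<in> J" for j
    using that J N by blast
  \<comment> \<open>The join lies below itself, hence so do its two parts.\<close>
  have le_add: "semiring_le M i (i \<oplus>\<^bsub>M\<^esub> j)" "semiring_le M j (i \<oplus>\<^bsub>M\<^esub> j)"
    if "i \<in> carrier M" "j \<in> carrier M" for i j
    using semimodule_le_add_iff[OF A M that, of "i \<oplus>\<^bsub>M\<^esub> j"] that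
      semimodule_add_idem[OF A M, of "i \<oplus>\<^bsub>M\<^esub> j"]
    by (auto simp: semiring_le_def)
  have trans: "semiring_le M x k"
    if "semiring_le M x j" "semiring_le M j k" "x \<in> carrier M" "j \<in> carrier M" "k \<in> carrier M"
    for x j k
    using that unfolding semiring_le_def by (metis M.a_assoc)
  show ?thesis
    unfolding semimodule_ideal_def mem_Collect_eq
  proof (intro conjI ballI iffI)
    show "\<exists>j\<in>J. semiring_le M \<zero>\<^bsub>M\<^esub> j"
      using J by (auto simp: semimodule_ideal_def semiring_le_def intro!: bexI[of _ "\<zero>\<^bsub>M\<^esub>"])
  next
    fix x y assume xy: "x \<in> carrier M" "y \<in> carrier M"
    show "\<exists>j\<in>J. semiring_le M x j" "\<exists>j\<in>J. semiring_le M y j"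
      if "\<exists>j\<in>J. semiring_le M (x \<oplus>\<^bsub>M\<^esub> y) j"
      using that semimodule_le_add_iff[OF A M xy] J_carrier by blast+
    assume "(\<exists>j\<in>J. semiring_le M x j) \<and> (\<exists>j\<in>J. semiring_le M y j)"
    then obtain i j where ij: "i \<in> J" "j \<in> J" "semiring_le M x i" "semiring_le M y j"
      by blast
    have "semiring_le M (x \<oplus>\<^bsub>M\<^esub> y) (i \<oplus>\<^bsub>M\<^esub> j)"
      using semimodule_le_add_iff[OF A M xy, of "i \<oplus>\<^bsub>M\<^esub> j"]
        trans[OF ij(3) le_add(1)] trans[OF ij(4) le_add(2)] ij J_carrier xy by auto
    then show "\<exists>j\<in>J. semiring_le M (x \<oplus>\<^bsub>M\<^esub> y) j"
      using J_add ij by blast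
  qed
qed

text \<open>The ideal property of \<open>J\<close> turns sums into intersections, and associativity
  (b a) x = b (a x) matches the scalar action of \<open>Id_semimodule A\<close>.\<close>

lemma semimodule_ideal_hom:
  assumes "idempotent_semiring A" "semimodule A M" and J: "semimodule_ideal M J"
  shows "(\<lambda>x. {a \<in> carrier A. a \<odot>\<^bsub>M\<^esub> x \<in> J}) \<in> semimodule_hom A M (Id_semimodule A)"
proof -
  interpret semimodule A M by fact
  have zero: "\<zero>\<^bsub>M\<^esub> \<in> J"
    and add: "x \<oplus>\<^bsub>M\<^esub> y \<in> J \<longleftrightarrow> x \<in> J \<and> y \<in> J" if "x \<in> carrier M" "y \<in> carrier M" for x y
    using J that by (auto simp: semimodule_ideal_def)
  have "{a \<in> carrier A. a \<odot>\<^bsub>M\<^esub> x \<in> J} \<in> semilattice_ideals A" if x: "x \<in> carrier M" for x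
  proof -
    have "\<zero>\<^bsub>A\<^esub> \<in> {a \<in> carrier A. a \<odot>\<^bsub>M\<^esub> x \<in> J}"
      using x zero[OF x x] by (simp add: smult_l_zero)
    \<comment> \<open>Downward closure: if b \<le> a then b x + a x = a x is in \<open>J\<close>,
      hence so is b x.\<close>
    moreover have "b \<odot>\<^bsub>M\<^esub> x \<in> J"
      if "a \<in> carrier A" "b \<in> carrier A" "a \<odot>\<^bsub>M\<^esub> x \<in> J" "b \<oplus>\<^bsub>A\<^esub> a = a" for a b
      using smult_l_distr[of b a x] add[of "b \<odot>\<^bsub>M\<^esub> x" "a \<odot>\<^bsub>M\<^esub> x"] that x
      by (simp add: smult_closed)
    ultimately show ?thesis
      using x add unfolding semilattice_ideals_def semiring_le_def
      by (auto simp: smult_l_distr smult_closed)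
  qed
  then show ?thesis
    using add
    by (auto simp: semimodule_hom_def Id_semimodule_def smult_r_distr smult_closed smult_assoc)
qed

section \<open>Injectivity of Id(A)\<close>

lemma subsemimodule_semimodule:
  assumes "semimodule A M" and "subsemimodule N A M"
  shows "semimodule A (M\<lparr>carrier := N\<rparr>)"
proof -
  interpret semimodule A M by fact
  interpret N: subsemimodule N A M by fact
  have sub: "x \<in> carrier M" if "x \<in> N" for x
    using that N.subset by auto
  have "comm_monoid (add_monoid (M\<lparr>carrier := N\<rparr>))"
    using N.m_closed N.one_closed by unfold_locales (auto simp: sub M.a_ac)
  then show ?thesis
    unfolding semimodule_def semimodule_axioms_def abelian_monoid_def
    using A.semiring_axioms N.one_closed
    by (auto simp: sub N.smult_closed smult_assoc smult_l_distr smult_r_distr smult_l_zero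
      smult_r_zero smult_one)
qed

lemma injective_Id_semimodule:
  fixes A :: "('a, 'c) ring_scheme"
  assumes A: "idempotent_semiring A"
  shows "injective_semimodule TYPE('u) A (Id_semimodule A)"
  unfolding injective_semimodule_def
proof (intro allI impI ballI, elim conjE)
  fix M :: "('a, 'u) module" and N \<alpha>
  assume M: "semimodule A M" and N: "subsemimodule N A M"
    and \<alpha>: "\<alpha> \<in> semimodule_hom A (M\<lparr>carrier := N\<rparr>) (Id_semimodule A)"
  interpret semimodule A M by fact
  interpret N: subsemimodule N A M by fact
  have N_sub: "N \<subseteq> carrier M" using N.subset by simp
  have N_add: "x \<oplus>\<^bsub>M\<^esub> y \<in> N" if "x \<in> N" "y \<in> N" for x y
    using N.m_closed[OF that] by simp
  have N_zero: "\<zero>\<^bsub>M\<^esub> \<in> N" using N.one_closed by simp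
  have \<alpha>_ideal: "\<alpha> x \<in> semilattice_ideals A" if "x \<in> N" for x
    using \<alpha> that by (auto simp: semimodule_hom_def Id_semimodule_def)
  have \<alpha>_add: "\<alpha> (x \<oplus>\<^bsub>M\<^esub> y) = \<alpha> x \<inter> \<alpha> y" if "x \<in> N" "y \<in> N" for x y
    using \<alpha> that by (auto simp: semimodule_hom_def Id_semimodule_def)
  have \<alpha>_smult: "\<alpha> (a \<odot>\<^bsub>M\<^esub> x) = {b \<in> carrier A. b \<otimes>\<^bsub>A\<^esub> a \<in> \<alpha> x}"
    if "x \<in> N" "a \<in> carrier A" for a x
    using \<alpha> that by (auto simp: semimodule_hom_def Id_semimodule_def)
  define J where "J = {x \<in> N. \<one>\<^bsub>A\<^esub> \<in> \<alpha> x}"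
  define J' where "J' = {x. \<exists>j \<in> J. semiring_le M x j}"
  have ideal_zero: "\<zero>\<^bsub>A\<^esub> \<in> I" if "I \<in> semilattice_ideals A" for I
    using that by (force simp: semilattice_ideals_def semiring_le_def)
  \<comment> \<open>Homomorphisms preserve zero only through scalars, so the zero of
    \<open>M\<close> is written as 0 times itself; then 1 0 = 0 lies in every ideal.\<close>
  have "\<one>\<^bsub>A\<^esub> \<in> \<alpha> (\<zero>\<^bsub>A\<^esub> \<odot>\<^bsub>M\<^esub> \<zero>\<^bsub>M\<^esub>)"
    using ideal_zero[OF \<alpha>_ideal[OF N_zero]] by (simp add: \<alpha>_smult[OF N_zero A.zero_closed])
  then have "\<zero>\<^bsub>M\<^esub> \<in> J"
    using N_zero by (simp add: J_def smult_l_zero)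
  then have J: "semimodule_ideal (M\<lparr>carrier := N\<rparr>) J"
    by (auto simp: semimodule_ideal_def J_def \<alpha>_add N_add)
  have J': "semimodule_ideal M J'"
    unfolding J'_def
    by (rule semimodule_ideal_generated[OF A M N_sub J _ N_add]) (auto simp: J_def)
  \<comment> \<open>If x \<le> j with \<open>j\<close> in \<open>J\<close>, then
    \<open>\<alpha> j\<close> is the intersection of \<open>\<alpha> x\<close> and
    \<open>\<alpha> j\<close>, so 1 passes from \<open>\<alpha> j\<close> to
    \<open>\<alpha> x\<close>.\<close>
  have trace: "x \<in> J' \<longleftrightarrow> x \<in> J" if "x \<in> N" for x
  proof
    assume "x \<in> J'"
    then obtain j where "j \<in> J" "x \<oplus>\<^bsub>M\<^esub> j = j"
      by (auto simp: J'_def semiring_le_def)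
    then show "x \<in> J"
      using \<alpha>_add[of x j] that by (auto simp: J_def)
  next
    assume "x \<in> J"
    then show "x \<in> J'"
      using semimodule_add_idem[OF A M] N_sub that
      by (auto simp: J'_def semiring_le_def)
  qed
  have "{a \<in> carrier A. a \<odot>\<^bsub>M\<^esub> x \<in> J'} = \<alpha> x" if x: "x \<in> N" for x
  proof -
    \<comment> \<open>On \<open>N\<close> the ideal \<open>J\<close> determines
      \<open>\<alpha>\<close>: 1 lies in \<open>\<alpha>\<close> of a x exactly when 1 a = a lies in
      \<open>\<alpha> x\<close>.\<close>
    have "a \<odot>\<^bsub>M\<^esub> x \<in> J' \<longleftrightarrow> a \<in> \<alpha> x" if "a \<in> carrier A" for a
      using trace[OF N.smult_closed[OF that x]] N.smult_closed[OF that x] that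
      by (simp add: J_def \<alpha>_smult[OF x])
    moreover have "\<alpha> x \<subseteq> carrier A"
      using \<alpha>_ideal[OF x] by (simp add: semilattice_ideals_def)
    ultimately show ?thesis by blast
  qed
  then show "\<exists>\<beta>\<in>semimodule_hom A M (Id_semimodule A). \<forall>x\<in>N. \<beta> x = \<alpha> x"
    by (intro bexI[OF _ semimodule_ideal_hom[OF A M J']]) simp
qed

section \<open>Powers, composites and retracts\<close>

text \<open>The universal property of the power. Extensionality fixes the values outside
  \<open>X\<close>, so that componentwise equations give equality of functions.\<close>

lemma semimodule_hom_power_iff:
  assumes "semimodule A M"
  shows "h \<in> semimodule_hom A M (power_semimodule E X) \<longleftrightarrow>
    h \<in> carrier M \<rightarrow> extensional X \<and> (\<forall>i \<in> X. (\<lambda>x. h x i) \<in> semimodule_hom A M E)"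
proof -
  interpret semimodule A M by fact
  show ?thesis (is "?L \<longleftrightarrow> ?R")
  proof
    show "?L \<Longrightarrow> ?R"
      by (auto simp: semimodule_hom_def power_semimodule_def Pi_iff PiE_iff)
  next
    assume R: ?R
    then have ext: "h x \<in> extensional X" if "x \<in> carrier M" for x
      using that by auto
    show ?L
      using R
      by (auto simp: semimodule_hom_def power_semimodule_def Pi_iff PiE_iff smult_closed
        intro!: extensionalityI[OF ext])
  qed
qed

lemma injective_power_semimodule:
  fixes A :: "('a, 'c) ring_scheme"
  assumes E: "injective_semimodule TYPE('u) A E"
  shows "injective_semimodule TYPE('u) A (power_semimodule E X)"
  unfolding injective_semimodule_def
proof (intro allI impI ballI, elim conjE)
  fix M :: "('a, 'u) module" and N \<alpha>
  assume M: "semimodule A M" and N: "subsemimodule N A M"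
    and \<alpha>: "\<alpha> \<in> semimodule_hom A (M\<lparr>carrier := N\<rparr>) (power_semimodule E X)"
  \<comment> \<open>Each coordinate of \<open>\<alpha>\<close> extends separately; the chosen
    extensions are then glued.\<close>
  have "\<forall>i \<in> X. \<exists>\<beta> \<in> semimodule_hom A M E. \<forall>x \<in> N. \<beta> x = \<alpha> x i"
    using \<alpha> E M N
    by (simp add: semimodule_hom_power_iff[OF subsemimodule_semimodule[OF M N]]
      injective_semimodule_def)
  then obtain \<beta> where \<beta>: "\<And>i. i \<in> X \<Longrightarrow> \<beta> i \<in> semimodule_hom A M E"
    and eq: "\<And>i x. i \<in> X \<Longrightarrow> x \<in> N \<Longrightarrow> \<beta> i x = \<alpha> x i"
    by metis
  have "\<alpha> x \<in> extensional X" if "x \<in> N" for x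
    using \<alpha> that by (auto simp: semimodule_hom_power_iff[OF subsemimodule_semimodule[OF M N]])
  then have "\<forall>x \<in> N. (\<lambda>i\<in>X. \<beta> i x) = \<alpha> x"
    by (auto simp: eq intro!: extensionalityI[of _ X])
  moreover have "(\<lambda>x. \<lambda>i\<in>X. \<beta> i x) \<in> semimodule_hom A M (power_semimodule E X)"
    using \<beta> by (simp add: semimodule_hom_power_iff[OF M])
  ultimately show
    "\<exists>\<gamma> \<in> semimodule_hom A M (power_semimodule E X). \<forall>x \<in> N. \<gamma> x = \<alpha> x"
    by (intro bexI[of _ "\<lambda>x. \<lambda>i\<in>X. \<beta> i x"]) auto
qed

lemma semimodule_hom_compose:
  assumes "g \<in> semimodule_hom A M N" "h \<in> semimodule_hom A N P"
  shows "(\<lambda>x. h (g x)) \<in> semimodule_hom A M P"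
  using assms by (auto simp: semimodule_hom_def Pi_iff)

text \<open>Push \<open>\<alpha>\<close> into \<open>E\<close> by \<open>s\<close>, extend there,
  and return by \<open>r\<close>; on \<open>N\<close> the composite of \<open>r\<close> and
  \<open>s\<close> cancels.\<close>

lemma injective_semimodule_retract:
  fixes A :: "('a, 'c) ring_scheme"
  assumes E: "injective_semimodule TYPE('u) A E" and "semimodule_retract A F E"
  shows "injective_semimodule TYPE('u) A F"
  unfolding injective_semimodule_def
proof (intro allI impI ballI, elim conjE)
  fix M :: "('a, 'u) module" and N \<alpha>
  assume M: "semimodule A M" and N: "subsemimodule N A M"
    and \<alpha>: "\<alpha> \<in> semimodule_hom A (M\<lparr>carrier := N\<rparr>) F"
  obtain r s where r: "r \<in> semimodule_hom A E F" and s: "s \<in> semimodule_hom A F E"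
    and rs: "\<forall>x \<in> carrier F. r (s x) = x"
    using assms(2) by (auto simp: semimodule_retract_def)
  obtain \<beta> where \<beta>: "\<beta> \<in> semimodule_hom A M E" and eq: "\<forall>x \<in> N. \<beta> x = s (\<alpha> x)"
    using E[unfolded injective_semimodule_def, rule_format, OF conjI[OF M N]
      semimodule_hom_compose[OF \<alpha> s]] by blast
  have "\<forall>x \<in> N. r (\<beta> x) = \<alpha> x"
    using eq rs \<alpha> by (auto simp: semimodule_hom_def)
  then show "\<exists>\<gamma> \<in> semimodule_hom A M F. \<forall>x \<in> N. \<gamma> x = \<alpha> x"
    using semimodule_hom_compose[OF \<beta> r] by (intro bexI[of _ "\<lambda>x. r (\<beta> x)"]) auto
qed

section \<open>Embeddings and the characterization\<close>

lemma subsemimodule_hom_image: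
  assumes "semimodule A M" "semimodule A P" and h: "h \<in> semimodule_hom A M P"
  shows "subsemimodule (h ` carrier M) A P"
proof -
  interpret semimodule A M by fact
  interpret P: semimodule A P by fact
  have h_mem: "h x \<in> carrier P" if "x \<in> carrier M" for x
    using h that by (auto simp: semimodule_hom_def)
  have h_add: "h x \<oplus>\<^bsub>P\<^esub> h y = h (x \<oplus>\<^bsub>M\<^esub> y)" if "x \<in> carrier M" "y \<in> carrier M" for x y
    using h that by (auto simp: semimodule_hom_def)
  have h_smult: "a \<odot>\<^bsub>P\<^esub> h x = h (a \<odot>\<^bsub>M\<^esub> x)" if "a \<in> carrier A" "x \<in> carrier M" for a x
    using h that by (auto simp: semimodule_hom_def)
  have "\<zero>\<^bsub>P\<^esub> = h \<zero>\<^bsub>M\<^esub>"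
    using h_smult[of "\<zero>\<^bsub>A\<^esub>" "\<zero>\<^bsub>M\<^esub>"] by (simp add: smult_l_zero P.smult_l_zero h_mem)
  then show ?thesis
    by unfold_locales (auto simp: h_mem h_add h_smult smult_closed)
qed

text \<open>Extending the inverse of \<open>h\<close> from the image to all of \<open>P\<close>
  yields the retraction. Injectivity is therefore required at the carrier type of
  \<open>P\<close>.\<close>

lemma injective_retract_of_embedding:
  fixes A :: "('a, 'c) ring_scheme" and P :: "('a, 'u) module"
  assumes M: "semimodule A M" and P: "semimodule A P"
    and inj: "injective_semimodule TYPE('u) A M"
    and h: "h \<in> semimodule_hom A M P" and h_inj: "inj_on h (carrier M)"
  shows "semimodule_retract A M P"
proof -
  interpret semimodule A M by fact
  let ?g = "inv_into (carrier M) h"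
  have g: "?g (h x) = x" if "x \<in> carrier M" for x
    using h_inj that by simp
  have "?g (h x \<oplus>\<^bsub>P\<^esub> h y) = x \<oplus>\<^bsub>M\<^esub> y" if "x \<in> carrier M" "y \<in> carrier M" for x y
    using h that g[of "x \<oplus>\<^bsub>M\<^esub> y"] by (simp add: semimodule_hom_def)
  moreover have "?g (a \<odot>\<^bsub>P\<^esub> h x) = a \<odot>\<^bsub>M\<^esub> x" if "a \<in> carrier A" "x \<in> carrier M" for a x
    using h that g[of "a \<odot>\<^bsub>M\<^esub> x"] by (simp add: semimodule_hom_def smult_closed)
  ultimately have "?g \<in> semimodule_hom A (P\<lparr>carrier := h ` carrier M\<rparr>) M"
    by (auto simp: semimodule_hom_def g)
  then obtain r where "r \<in> semimodule_hom A P M" "\<forall>y \<in> h ` carrier M. r y = ?g y"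
    using inj P subsemimodule_hom_image[OF M P h] unfolding injective_semimodule_def by blast
  then show ?thesis
    using h g unfolding semimodule_retract_def by (metis imageI)
qed

text \<open>Coordinate \<open>y\<close> is the homomorphism attached to the principal ideal below
  \<open>y\<close>. Together the coordinates record all upper bounds of \<open>x\<close>, which
  determine \<open>x\<close>.\<close>

lemma semimodule_embedding_Id_power:
  assumes A: "idempotent_semiring A" and M: "semimodule A M"
  obtains h where "h \<in> semimodule_hom A M (power_semimodule (Id_semimodule A) (carrier M))"
    and "inj_on h (carrier M)"
proof
  interpret semimodule A M by fact
  let ?h = "\<lambda>x. \<lambda>y\<in>carrier M. {a \<in> carrier A. semiring_le M (a \<odot>\<^bsub>M\<^esub> x) y}"
  show "?h \<in> semimodule_hom A M (power_semimodule (Id_semimodule A) (carrier M))"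
    using semimodule_ideal_hom[OF A M semimodule_ideal_principal[OF A M]]
    by (simp add: semimodule_hom_power_iff[OF M])
  show "inj_on ?h (carrier M)"
  proof
    fix x y assume xy: "x \<in> carrier M" "y \<in> carrier M" and eq: "?h x = ?h y"
    \<comment> \<open>Membership of the scalar 1 in a coordinate recovers the order.\<close>
    have le: "semiring_le M x z \<longleftrightarrow> semiring_le M y z" if "z \<in> carrier M" for z
    proof -
      have "\<one>\<^bsub>A\<^esub> \<in> ?h x z \<longleftrightarrow> \<one>\<^bsub>A\<^esub> \<in> ?h y z" by (simp only: eq)
      then show ?thesis using that xy by (simp add: smult_one)
    qed
    \<comment> \<open>Taking \<open>z\<close> to be \<open>x\<close> and then \<open>y\<close> gives
      both inequalities by reflexivity.\<close>
    then have "y \<oplus>\<^bsub>M\<^esub> x = x" "x \<oplus>\<^bsub>M\<^esub> y = y"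
      using le[OF xy(1)] le[OF xy(2)] xy semimodule_add_idem[OF A M]
      by (simp_all add: semiring_le_def)
    then show "x = y" using M.a_comm[OF xy] by simp
  qed
qed

text \<open>The type \<open>'m \<Rightarrow> 'a set\<close> houses the power of Id(A) indexed by
  \<open>carrier M\<close>, so injectivity there already forces a retract; the second conjunct then
  gives injectivity at an arbitrary type \<open>'u\<close>.\<close>

theorem corollary7:
  fixes A :: "('a, 'c) ring_scheme"
    and M :: "('a, 'm, 'd) module_scheme"
  assumes "idempotent_semiring A"
    and "semimodule A M"
  shows "(injective_semimodule TYPE('m \<Rightarrow> 'a set) A M \<longleftrightarrow>
            (\<exists>X :: 'm set. semimodule_retract A M (power_semimodule (Id_semimodule A) X))) \<and>
         ((\<exists>X :: 'x set. semimodule_retract A M (power_semimodule (Id_semimodule A) X)) \<longrightarrow>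
            injective_semimodule TYPE('u) A M)"
proof (intro conjI iffI impI; (elim exE)?)
  assume inj: "injective_semimodule TYPE('m \<Rightarrow> 'a set) A M"
  interpret idempotent_semiring A by fact
  obtain h where "h \<in> semimodule_hom A M (power_semimodule (Id_semimodule A) (carrier M))"
    and "inj_on h (carrier M)"
    using semimodule_embedding_Id_power[OF assms] .
  then show "\<exists>X :: 'm set. semimodule_retract A M (power_semimodule (Id_semimodule A) X)"
    using injective_retract_of_embedding[OF assms(2) semimodule_power[OF semimodule_Id] inj]
    by blast
\<comment> \<open>Both remaining goals lead from a retract to injectivity, at the two different
  types.\<close>
qed (rule injective_semimodule_retract[OF
    injective_power_semimodule[OF injective_Id_semimodule[OF assms(1)]]], assumption)+

end
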